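(* Let $\Gamma$ be a connected regular graph of valency $k$ with exactly four distinct eigenvalues $k>\theta_1>\theta_2>\theta_3$. If $\theta_2=0$ and $\theta_3=-\theta_1$, then $\Gamma$ is strongly $\ell$-walk-regular for every odd integer $\ell>1$.
   Context: Graphs are finite, simple and undirected. For an integer $\ell>1$, a graph $\Gamma$ is strongly $\ell$-walk-regular with parameters $(\lambda_\ell,\mu_\ell,\nu_\ell)$ if the number of walks of length $\ell$ between two vertices is $\lambda_\ell$ for every two adjacent vertices, $\mu_\ell$ for every two distinct non-adjacent vertices, and $\nu_\ell$ for every two identical vertices (i.e. from each vertex to itself). It is strongly $\ell$-walk-regular if this holds for some $\lambda_\ell,\mu_\ell,\nu_\ell$. Eigenvalues of a graph are the eigenvalues of its adjacency matrix. *)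

theory Defs
  imports
    "Graph_Theory.Graph_Theory"
    "Jordan_Normal_Form.Spectral_Radius"
begin

text \<open>
  A finite simple undirected graph is the locale predicate \<^locale>\<open>graph\<close>: each edge is
  represented by its two opposite arcs, with no loops and no parallel arcs. Consequently arc walks
  correspond one-to-one to walks given by their vertex sequences, and the valency of a vertex is its
  out-degree.
\<close>

definition regular_of_valency :: "('a, 'b) pre_digraph \<Rightarrow> nat \<Rightarrow> bool" where
  "regular_of_valency G k \<longleftrightarrow> (\<forall>v \<in> verts G. out_degree G v = k)"

definition num_walks :: "('a, 'b) pre_digraph \<Rightarrow> nat \<Rightarrow> 'a \<Rightarrow> 'a \<Rightarrow> nat" where
  "num_walks G l u v = card {p. pre_digraph.awalk G u p v \<and> length p = l}"

definition strongly_walk_regular_with ::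
    "('a, 'b) pre_digraph \<Rightarrow> nat \<Rightarrow> nat \<Rightarrow> nat \<Rightarrow> nat \<Rightarrow> bool" where
  "strongly_walk_regular_with G l lam mu nu \<longleftrightarrow> 1 < l \<and>
     (\<forall>u \<in> verts G. \<forall>v \<in> verts G. u \<rightarrow>\<^bsub>G\<^esub> v \<longrightarrow> num_walks G l u v = lam) \<and>
     (\<forall>u \<in> verts G. \<forall>v \<in> verts G. u \<noteq> v \<and> \<not> u \<rightarrow>\<^bsub>G\<^esub> v \<longrightarrow> num_walks G l u v = mu) \<and>
     (\<forall>u \<in> verts G. num_walks G l u u = nu)"

definition strongly_walk_regular :: "('a, 'b) pre_digraph \<Rightarrow> nat \<Rightarrow> bool" where
  "strongly_walk_regular G l \<longleftrightarrow> (\<exists>lam mu nu. strongly_walk_regular_with G l lam mu nu)"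

text \<open>
  Matrices are indexed by \<open>0, \<dots>, n - 1\<close>, so the adjacency matrix depends on an enumeration \<open>vs\<close> of
  the vertices. Its spectrum does not, see \<open>graph_spectrum_eq\<close> below.
\<close>

definition adjacency_matrix :: "('a, 'b) pre_digraph \<Rightarrow> 'a list \<Rightarrow> real mat" where
  "adjacency_matrix G vs =
     mat (length vs) (length vs) (\<lambda>(i, j). if vs ! i \<rightarrow>\<^bsub>G\<^esub> vs ! j then 1 else 0)"

text \<open>
  No eigenvalues are lost by restricting to real ones, because the adjacency matrix of an undirected graph is symmetric.
\<close>

definition graph_spectrum :: "('a, 'b) pre_digraph \<Rightarrow> real set" where
  "graph_spectrum G =
     {x. \<exists>vs. distinct vs \<and> set vs = verts G \<and> eigenvalue (adjacency_matrix G vs) x}"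

lemma eigenvalue_adjacency_matrix_iff:
  assumes vs: "distinct vs" "set vs = verts G"
  shows "eigenvalue (adjacency_matrix G vs) x \<longleftrightarrow>
    (\<exists>f. (\<exists>u \<in> verts G. f u \<noteq> 0) \<and>
      (\<forall>u \<in> verts G. (\<Sum>v \<in> verts G. if u \<rightarrow>\<^bsub>G\<^esub> v then f v else 0) = x * f u))"
proof -
  let ?n = "length vs" and ?A = "adjacency_matrix G vs"
  have bij: "bij_betw ((!) vs) {0..<?n} (verts G)"
    using bij_betw_nth[OF vs(1), of "{0..<?n}"] vs(2) by (simp add: atLeast0LessThan)
  have sum: "(\<Sum>v \<in> verts G. g v) = (\<Sum>i = 0..<?n. g (vs ! i))" for g :: "'a \<Rightarrow> real"
    by (rule sum.reindex_bij_betw[OF bij, symmetric])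
  have ex: "(\<exists>u \<in> verts G. P u) \<longleftrightarrow> (\<exists>i < ?n. P (vs ! i))" for P
    unfolding vs(2)[symmetric] set_conv_nth by blast
  have all: "(\<forall>u \<in> verts G. P u) \<longleftrightarrow> (\<forall>i < ?n. P (vs ! i))" for P
    unfolding vs(2)[symmetric] set_conv_nth by blast
  have vec: "eigenvector ?A w x \<longleftrightarrow> dim_vec w = ?n \<and> (\<exists>i < ?n. w $ i \<noteq> 0) \<and>
      (\<forall>i < ?n. (\<Sum>j = 0..<?n. if vs ! i \<rightarrow>\<^bsub>G\<^esub> vs ! j then w $ j else 0) = x * w $ i)" for w
  proof (cases "dim_vec w = ?n")
    case True
    have "(?A *\<^sub>v w) $ i = (\<Sum>j = 0..<?n. if vs ! i \<rightarrow>\<^bsub>G\<^esub> vs ! j then w $ j else 0)" if "i < ?n" for i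
      using that True
      by (auto simp: adjacency_matrix_def scalar_prod_def intro!: sum.cong)
    then have "?A *\<^sub>v w = x \<cdot>\<^sub>v w \<longleftrightarrow>
      (\<forall>i < ?n. (\<Sum>j = 0..<?n. if vs ! i \<rightarrow>\<^bsub>G\<^esub> vs ! j then w $ j else 0) = x * w $ i)"
      using True unfolding vec_eq_iff by (simp add: adjacency_matrix_def)
    moreover have "w \<noteq> 0\<^sub>v ?n \<longleftrightarrow> (\<exists>i < ?n. w $ i \<noteq> 0)"
      using True by (auto simp: vec_eq_iff)
    moreover have "dim_row ?A = ?n" by (simp add: adjacency_matrix_def)
    ultimately show ?thesis
      using True unfolding eigenvector_def carrier_vec_def by (simp only: mem_Collect_eq simp_thms)
  next
    case False
    moreover have "dim_row ?A = ?n" by (simp add: adjacency_matrix_def)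
    ultimately show ?thesis
      unfolding eigenvector_def carrier_vec_def by (simp only: mem_Collect_eq simp_thms)
  qed
  show ?thesis
  proof
    assume "eigenvalue ?A x"
    then obtain w where w: "eigenvector ?A w x" unfolding eigenvalue_def by blast
    define f where "f u = w $ (the_inv_into {0..<?n} ((!) vs) u)" for u
    have f: "f (vs ! i) = w $ i" if "i < ?n" for i
      unfolding f_def using that bij by (simp add: bij_betw_def the_inv_into_f_f)
    show "\<exists>f. (\<exists>u \<in> verts G. f u \<noteq> 0) \<and>
      (\<forall>u \<in> verts G. (\<Sum>v \<in> verts G. if u \<rightarrow>\<^bsub>G\<^esub> v then f v else 0) = x * f u)"
    proof (intro exI[of _ f] conjI)
      show "\<exists>u \<in> verts G. f u \<noteq> 0"
        using w f unfolding vec ex by metis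
      have "(\<Sum>j = 0..<?n. if vs ! i \<rightarrow>\<^bsub>G\<^esub> vs ! j then f (vs ! j) else 0) =
          (\<Sum>j = 0..<?n. if vs ! i \<rightarrow>\<^bsub>G\<^esub> vs ! j then w $ j else 0)" for i
        by (rule sum.cong) (simp_all add: f)
      then show "\<forall>u \<in> verts G. (\<Sum>v \<in> verts G. if u \<rightarrow>\<^bsub>G\<^esub> v then f v else 0) = x * f u"
        using w f unfolding vec all sum by presburger
    qed
  next
    assume "\<exists>f. (\<exists>u \<in> verts G. f u \<noteq> 0) \<and>
      (\<forall>u \<in> verts G. (\<Sum>v \<in> verts G. if u \<rightarrow>\<^bsub>G\<^esub> v then f v else 0) = x * f u)"
    then obtain f where f: "\<exists>i < ?n. f (vs ! i) \<noteq> 0"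
      "\<forall>i < ?n. (\<Sum>j = 0..<?n. if vs ! i \<rightarrow>\<^bsub>G\<^esub> vs ! j then f (vs ! j) else 0) = x * f (vs ! i)"
      unfolding ex all sum by blast
    have "eigenvector ?A (Matrix.vec ?n (\<lambda>i. f (vs ! i))) x"
    proof -
      have eq: "(\<Sum>j = 0..<?n. if vs ! i \<rightarrow>\<^bsub>G\<^esub> vs ! j then Matrix.vec ?n (\<lambda>i. f (vs ! i)) $ j else 0) =
          (\<Sum>j = 0..<?n. if vs ! i \<rightarrow>\<^bsub>G\<^esub> vs ! j then f (vs ! j) else 0)" for i
        by (rule sum.cong) simp_all
      show ?thesis
        unfolding vec eq
      proof (intro conjI)
        show "\<exists>i < ?n. Matrix.vec ?n (\<lambda>i. f (vs ! i)) $ i \<noteq> 0"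
          using f(1) index_vec by metis
        show "\<forall>i < ?n. (\<Sum>j = 0..<?n. if vs ! i \<rightarrow>\<^bsub>G\<^esub> vs ! j then f (vs ! j) else 0) =
            x * Matrix.vec ?n (\<lambda>i. f (vs ! i)) $ i"
          using f(2) index_vec by metis
      qed simp
    qed
    then show "eigenvalue ?A x" unfolding eigenvalue_def by blast
  qed
qed

lemma graph_spectrum_eq:
  assumes "distinct vs" "set vs = verts G"
  shows "graph_spectrum G = spectrum (adjacency_matrix G vs)"
proof -
  have "eigenvalue (adjacency_matrix G ws) x \<longleftrightarrow> eigenvalue (adjacency_matrix G vs) x"
    if "distinct ws" "set ws = verts G" for ws x
    by (simp only: eigenvalue_adjacency_matrix_iff[OF that] eigenvalue_adjacency_matrix_iff[OF assms])
  then show ?thesis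
    unfolding graph_spectrum_def spectrum_def using assms by blast
qed

end

theory Submission
  imports Defs
begin

text \<open>
  A real symmetric matrix is annihilated by the product of \<open>A - r I\<close> over a list containing all its
  eigenvalues \<open>r\<close>: this product is symmetric and similar to a strictly upper triangular matrix, so its
  square has trace zero. Hence \<open>(A - k I) (A\<^sup>3 - \<theta>\<^sub>1\<^sup>2 A) = 0\<close> for the adjacency matrix \<open>A\<close>. In a connected
  regular graph the eigenvectors for \<open>k\<close> are constant, so the columns of the symmetric matrix
  \<open>A\<^sup>3 - \<theta>\<^sub>1\<^sup>2 A\<close> are constant and it is a multiple of the all-one matrix \<open>J\<close>. Since \<open>A J = k J\<close>, every
  odd power of \<open>A\<close> is then a linear combination of \<open>A\<close> and \<open>J\<close>.
\<close>

section \<open>Monic polynomials of a matrix, given by a list of roots\<close>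

fun root_prod :: "'a :: comm_ring_1 mat \<Rightarrow> 'a list \<Rightarrow> 'a mat" where
  "root_prod A [] = 1\<^sub>m (dim_row A)"
| "root_prod A (r # rs) = (A - r \<cdot>\<^sub>m 1\<^sub>m (dim_row A)) * root_prod A rs"

lemma root_prod_carrier [simp, intro]:
  assumes "A \<in> carrier_mat n n"
  shows "root_prod A rs \<in> carrier_mat n n"
  using assms by (induction rs) auto

lemma mult_minus_smult_one:
  fixes A M :: "'a :: comm_ring_1 mat"
  assumes A: "A \<in> carrier_mat n n" and M: "M \<in> carrier_mat n n"
  shows "M * (A - r \<cdot>\<^sub>m 1\<^sub>m n) = M * A - r \<cdot>\<^sub>m M"
    and "(A - r \<cdot>\<^sub>m 1\<^sub>m n) * M = A * M - r \<cdot>\<^sub>m M"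
proof -
  have one: "1\<^sub>m n \<in> carrier_mat n n" "r \<cdot>\<^sub>m 1\<^sub>m n \<in> carrier_mat n n" by auto
  show "M * (A - r \<cdot>\<^sub>m 1\<^sub>m n) = M * A - r \<cdot>\<^sub>m M"
    using mult_minus_distrib_mat[OF M A one(2)] mult_smult_distrib[OF M one(1), of r] M by simp
  show "(A - r \<cdot>\<^sub>m 1\<^sub>m n) * M = A * M - r \<cdot>\<^sub>m M"
    using minus_mult_distrib_mat[OF A one(2) M] mult_smult_assoc_mat[OF one(1) M, of r] M by simp
qed

lemma root_prod_commute:
  assumes A: "A \<in> carrier_mat n n"
  shows "A * root_prod A rs = root_prod A rs * A"
proof (induction rs)
  case Nil
  then show ?case using A by simp
next
  case (Cons r rs)
  let ?M = "root_prod A rs" and ?D = "A - r \<cdot>\<^sub>m 1\<^sub>m n"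
  have M: "?M \<in> carrier_mat n n" and D: "?D \<in> carrier_mat n n" using A by auto
  have "A * ?D = ?D * A"
    by (simp add: mult_minus_smult_one[OF A A])
  then have "A * (?D * ?M) = ?D * (A * ?M)"
    using assoc_mult_mat[OF A D M] assoc_mult_mat[OF D A M] by simp
  also have "\<dots> = (?D * ?M) * A" using Cons.IH assoc_mult_mat[OF D M A] by simp
  finally show ?case using A by simp
qed

text \<open>Transposition reverses the order of the factors; \<open>root_prod_commute\<close>
  restores it.\<close>

lemma transpose_root_prod:
  assumes A: "A \<in> carrier_mat n n" and sym: "transpose_mat A = A"
  shows "transpose_mat (root_prod A rs) = root_prod A rs"
proof (induction rs)
  case Nil
  then show ?case by simp
next
  case (Cons r rs)
  let ?M = "root_prod A rs" and ?D = "A - r \<cdot>\<^sub>m 1\<^sub>m n"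
  have M: "?M \<in> carrier_mat n n" and D: "?D \<in> carrier_mat n n" using A by auto
  have "transpose_mat ?D = ?D"
  proof (rule eq_matI)
    fix i j assume "i < dim_row ?D" "j < dim_col ?D"
    then show "transpose_mat ?D $$ (i, j) = ?D $$ (i, j)"
      using A arg_cong[OF sym, of "\<lambda>X. X $$ (i, j)"] by auto
  qed (use A in auto)
  then have "transpose_mat (?D * ?M) = ?M * ?D"
    using transpose_mult[OF D M] Cons.IH by simp
  also have "\<dots> = ?D * ?M"
    by (simp add: mult_minus_smult_one[OF A M] root_prod_commute[OF A])
  finally show ?case using A by simp
qed

section \<open>Similarity, triangular matrices and the trace\<close>

lemma similar_mat_wit_mult:
  assumes A: "similar_mat_wit A B P Q" and A': "similar_mat_wit A' B' P Q"
  shows "similar_mat_wit (A * A') (B * B') P Q"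
proof -
  define n where "n = dim_row A"
  note a = similar_mat_witD[OF n_def A]
  \<comment> \<open>The two similarities share \<open>P\<close>, whose shape forces
    \<open>A'\<close> to have the size of \<open>A\<close>.\<close>
  have "dim_row A' = n"
    using similar_mat_witD(6)[OF refl A'] a(6) by auto
  note a' = similar_mat_witD[OF this[symmetric] A']
  have PB: "P * B \<in> carrier_mat n n" and BQ: "B' * Q \<in> carrier_mat n n"
    using a(5,6,7) a'(5) by auto
  have "A * A' = P * B * Q * (P * (B' * Q))"
    unfolding a(3) a'(3) assoc_mult_mat[OF a'(6,5,7)] ..
  \<comment> \<open>Regrouping brings \<open>Q * P\<close> together in the middle, where it
    cancels.\<close>
  also have "\<dots> = P * B * ((Q * P) * (B' * Q))"
    unfolding assoc_mult_mat[OF PB a(7) mult_carrier_mat[OF a(6) BQ]] assoc_mult_mat[OF a(7,6) BQ] ..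
  also have "\<dots> = P * (B * B') * Q"
    unfolding a(2) left_mult_one_mat[OF BQ] assoc_mult_mat[OF a(6,5) BQ]
      assoc_mult_mat[OF a(5) a'(5) a(7), symmetric]
    using a(5-7) a'(5) by (intro assoc_mult_mat[symmetric]) auto
  finally show ?thesis
    using a(1,2,4-7) a'(4,5) by (intro similar_mat_witI[of _ _ n]) auto
qed

text \<open>Conjugation fixes scalar matrices, so the same \<open>P\<close> and \<open>Q\<close>
  serve every factor, and the products of the factors correspond as well.\<close>

lemma similar_mat_wit_root_prod:
  assumes "similar_mat_wit A B P Q"
  shows "similar_mat_wit (root_prod A rs) (root_prod B rs) P Q"
proof (induction rs)
  define n where "n = dim_row A"
  note a = similar_mat_witD[OF n_def assms]
  have one: "similar_mat_wit (1\<^sub>m n) (1\<^sub>m n) P Q"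
    using a(1,2,6,7) by (intro similar_mat_witI[of _ _ n]) auto
  {
    case Nil
    then show ?case using a(4,5) one by simp
  next
    case (Cons r rs)
    have "A - r \<cdot>\<^sub>m 1\<^sub>m n = P * (B - r \<cdot>\<^sub>m 1\<^sub>m n) * Q"
    proof -
      have "P * (B - r \<cdot>\<^sub>m 1\<^sub>m n) = P * B - r \<cdot>\<^sub>m P"
        by (rule mult_minus_smult_one(1)[OF a(5,6)])
      then have "P * (B - r \<cdot>\<^sub>m 1\<^sub>m n) * Q = P * B * Q - (r \<cdot>\<^sub>m P) * Q"
        using a(5-7) minus_mult_distrib_mat[of "P * B" n n "r \<cdot>\<^sub>m P" Q n] by simp
      then show ?thesis
        using a(1,3,6,7) mult_smult_assoc_mat[of P n n Q n r] by simp
    qed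
    then have "similar_mat_wit (A - r \<cdot>\<^sub>m 1\<^sub>m n) (B - r \<cdot>\<^sub>m 1\<^sub>m n) P Q"
      using a(1,2,4-7) by (intro similar_mat_witI[of _ _ n]) auto
    from similar_mat_wit_mult[OF this Cons] show ?case using a(4,5) by simp
  }
qed

text \<open>A term of the sum for entry \<open>(i, j)\<close> can be nonzero only if
  \<open>i <= m <= j\<close>. This leaves no term below the diagonal and only \<open>m = i\<close>
  on it.\<close>

lemma upper_triangular_mult:
  fixes A B :: "'a :: semiring_0 mat"
  assumes A: "A \<in> carrier_mat n n" "upper_triangular A"
    and B: "B \<in> carrier_mat n n" "upper_triangular B"
  shows "upper_triangular (A * B)"
    and "i < n \<Longrightarrow> (A * B) $$ (i, i) = A $$ (i, i) * B $$ (i, i)"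
proof -
  have ent: "(A * B) $$ (i, j) = (\<Sum>m<n. A $$ (i, m) * B $$ (m, j))" if "i < n" "j < n" for i j
    using that A(1) B(1) by (simp add: scalar_prod_def atLeast0LessThan)
  have z: "A $$ (i, m) * B $$ (m, j) = 0" if "i < n" "m < n" "m < i \<or> j < m" for i j m
    using that upper_triangularD[OF A(2), of m i] upper_triangularD[OF B(2), of j m] A(1) B(1) by auto
  show "upper_triangular (A * B)"
  proof (rule upper_triangularI)
    fix i j assume ij: "j < i" "i < dim_row (A * B)"
    then have "A $$ (i, m) * B $$ (m, j) = 0" if "m < n" for m
      using z[of i m j] that A(1) by (cases "m < i") auto
    then show "(A * B) $$ (i, j) = 0"
      using ent[of i j] ij A(1) by simp
  qed
  assume i: "i < n"
  have "(\<Sum>m<n. A $$ (i, m) * B $$ (m, i)) = (\<Sum>m\<in>{i}. A $$ (i, m) * B $$ (m, i))"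
    using i z[of i _ i] by (intro sum.mono_neutral_right) (auto simp: neq_iff)
  then show "(A * B) $$ (i, i) = A $$ (i, i) * B $$ (i, i)"
    using ent[OF i i] by simp
qed

lemma upper_triangular_root_prod:
  assumes B: "B \<in> carrier_mat n n" "upper_triangular B"
  shows "upper_triangular (root_prod B rs)"
    and "i < n \<Longrightarrow> root_prod B rs $$ (i, i) = (\<Prod>r\<leftarrow>rs. B $$ (i, i) - r)"
proof (induction rs)
  case (Cons r rs)
  have D: "B - r \<cdot>\<^sub>m 1\<^sub>m n \<in> carrier_mat n n" "upper_triangular (B - r \<cdot>\<^sub>m 1\<^sub>m n)"
    using B by (auto intro!: upper_triangularI dest: upper_triangularD)
  {
    case 1
    show ?case using upper_triangular_mult(1)[OF D _ Cons(1)] B by auto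
  next
    case 2
    then show ?case using upper_triangular_mult(2)[OF D _ Cons(1)] Cons(2) B by auto
  }
qed (use B in auto)

definition trace_mat :: "'a :: comm_ring_1 mat \<Rightarrow> 'a" where
  "trace_mat A = (\<Sum>i<dim_row A. A $$ (i, i))"

lemma trace_mat_mult_commute:
  assumes "A \<in> carrier_mat n m" "B \<in> carrier_mat m n"
  shows "trace_mat (A * B) = trace_mat (B * A)"
proof -
  have "trace_mat (A * B) = (\<Sum>i<n. \<Sum>j<m. A $$ (i, j) * B $$ (j, i))"
    using assms by (auto simp: trace_mat_def scalar_prod_def atLeast0LessThan)
  also have "\<dots> = (\<Sum>j<m. \<Sum>i<n. B $$ (j, i) * A $$ (i, j))"
    by (subst sum.swap) (simp add: mult.commute)
  also have "\<dots> = trace_mat (B * A)"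
    using assms by (auto simp: trace_mat_def scalar_prod_def atLeast0LessThan)
  finally show ?thesis .
qed

text \<open>Cyclicity of the trace moves \<open>Q\<close> to the front, where it cancels
  \<open>P\<close>.\<close>

lemma trace_mat_similar:
  assumes "similar_mat_wit A B P Q"
  shows "trace_mat A = trace_mat B"
proof -
  define n where "n = dim_row A"
  note a = similar_mat_witD[OF n_def assms]
  have "trace_mat A = trace_mat (Q * (P * B))"
    using a trace_mat_mult_commute[of "P * B" n n Q] by auto
  also have "Q * (P * B) = B"
    using a(2,4-7) assoc_mult_mat[of Q n n P n B n] by simp
  finally show ?thesis .
qed

section \<open>Spectral properties of real symmetric matrices\<close>

lemma eigenvalue_symmetric_real:
  fixes A :: "real mat" and e :: complex
  assumes A: "A \<in> carrier_mat n n" and sym: "transpose_mat A = A"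
    and e: "eigenvalue (map_mat of_real A) e"
  shows "e \<in> \<real>"
proof -
  let ?C = "map_mat of_real A :: complex mat"
  have C: "?C \<in> carrier_mat n n" and Csym: "transpose_mat ?C = ?C"
    using A sym by (auto simp: map_mat_transpose)
  obtain v where v: "v \<in> carrier_vec n" "v \<noteq> 0\<^sub>v n" "?C *\<^sub>v v = e \<cdot>\<^sub>v v"
    using e C unfolding eigenvalue_def eigenvector_def by auto
  \<comment> \<open>The entries of \<open>?C\<close> are real, so multiplication by it commutes with
    conjugation.\<close>
  have conj: "?C *\<^sub>v conjugate v = conjugate (?C *\<^sub>v v)"
  proof (rule eq_vecI)
    fix i assume "i < dim_vec (conjugate (?C *\<^sub>v v))"
    then show "(?C *\<^sub>v conjugate v) $ i = conjugate (?C *\<^sub>v v) $ i"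
      using A v(1) by (auto simp: scalar_prod_def)
  qed simp
  \<comment> \<open>Letting \<open>?C\<close> act on the left or on the right argument of the
    Hermitian form gives the factors \<open>e\<close> and \<open>cnj e\<close>; the form is nonzero
    at \<open>v\<close>.\<close>
  have "e * (v \<bullet> conjugate v) = (?C *\<^sub>v v) \<bullet> conjugate v"
    using v by simp
  also have "\<dots> = v \<bullet> (?C *\<^sub>v conjugate v)"
    using transpose_vec_mult_scalar[OF C, of "conjugate v" v] Csym v(1) 
    by (simp)
  also have "\<dots> = cnj e * (v \<bullet> conjugate v)"
    unfolding conj v(3) using v(1) by (simp add: conjugate_smult_vec)
  finally have "e = cnj e"
    using conjugate_square_eq_0_vec[OF v(1)] v(2) by simp
  then show ?thesis by (simp add: Reals_cnj_iff)
qed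

text \<open>The complex roots are real, so they equal their real parts, and injectivity of the
  coefficient embedding carries the complex factorization back to the reals.
  \<open>schur_decomposition\<close> takes such a factorization as input.\<close>

lemma char_poly_symmetric_real_splits:
  fixes A :: "real mat"
  assumes A: "A \<in> carrier_mat n n" and sym: "transpose_mat A = A"
  shows "\<exists>es. char_poly A = (\<Prod>e\<leftarrow>es. [:- e, 1:])"
proof -
  interpret poly: map_poly_inj_comm_ring_hom "of_real :: real \<Rightarrow> complex" ..
  let ?C = "map_mat of_real A :: complex mat"
  have C: "?C \<in> carrier_mat n n" using A by auto
  obtain cs where cs: "char_poly ?C = (\<Prod>e\<leftarrow>cs. [:- e, 1:])"
    using char_poly_factorized[OF C] by auto
  have "e \<in> \<real>" if "e \<in> set cs" for e
  proof (rule eigenvalue_symmetric_real[OF A sym])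
    show "eigenvalue ?C e"
      unfolding eigenvalue_root_char_poly[OF C] cs using that by (simp add: linear_poly_root)
  qed
  then have lin: "map (\<lambda>e. [:- e, 1:]) cs = map (\<lambda>e. [:- of_real e, 1:]) (map Re cs)"
    by (auto elim: Reals_cases)
  have "map_poly of_real (char_poly A) = (\<Prod>e\<leftarrow>map Re cs. [:- of_real e, 1 :: complex:])"
    unfolding of_real_hom.char_poly_hom[OF A, symmetric] cs lin ..
  also have "\<dots> = map_poly of_real (\<Prod>e\<leftarrow>map Re cs. [:- e, 1:])"
    by (simp add: poly.hom_prod_list o_def)
  finally show ?thesis
    by (intro exI[of _ "map Re cs"]) (metis poly.injectivity)
qed

lemma root_prod_symmetric_real_eq_0:
  fixes A :: "real mat"
  assumes A: "A \<in> carrier_mat n n" and sym: "transpose_mat A = A"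
    and rs: "\<And>e. eigenvalue A e \<Longrightarrow> e \<in> set rs"
  shows "root_prod A rs = 0\<^sub>m n n"
proof -
  let ?M = "root_prod A rs"
  have M: "?M \<in> carrier_mat n n" using A by auto
  obtain es where es: "char_poly A = (\<Prod>e\<leftarrow>es. [:- e, 1:])"
    using char_poly_symmetric_real_splits[OF A sym] by blast
  obtain B P Q where "schur_decomposition A es = (B, P, Q)"
    by (cases "schur_decomposition A es")
  from schur_decomposition[OF A es this]
  have sim: "similar_mat_wit A B P Q" and ut: "upper_triangular B" and diag: "diag_mat B = es"
    by auto
  note B = similar_mat_witD2(5)[OF A sim]
  let ?N = "root_prod B rs"
  have N: "?N \<in> carrier_mat n n" using B by auto
  note utN = upper_triangular_root_prod(1)[OF B ut, of rs]
  have diagN: "?N $$ (i, i) = 0" if i: "i < n" for i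
  proof -
    \<comment> \<open>Each diagonal entry of \<open>B\<close> is an eigenvalue of \<open>A\<close>,
      hence occurs in \<open>rs\<close> and makes one factor of the diagonal product vanish.\<close>
    have "B $$ (i, i) \<in> set es" unfolding diag[symmetric] using B i by (auto simp: diag_mat_def)
    then have "eigenvalue A (B $$ (i, i))"
      unfolding eigenvalue_root_char_poly[OF A] es by (simp add: linear_poly_root)
    then have "B $$ (i, i) \<in> set rs" by (rule rs)
    then show ?thesis
      unfolding upper_triangular_root_prod(2)[OF B ut i] by (auto simp: prod_list_zero_iff)
  qed
  have "trace_mat (?M * ?M) = trace_mat (?N * ?N)"
    by (intro trace_mat_similar[of _ _ P Q] similar_mat_wit_mult similar_mat_wit_root_prod sim)
  also have "\<dots> = 0"
    using N upper_triangular_mult(2)[OF N utN N utN] diagN by (simp add: trace_mat_def)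
  finally have "(\<Sum>i<n. \<Sum>j<n. ?M $$ (i, j) * ?M $$ (j, i)) = 0"
    using M by (simp add: trace_mat_def scalar_prod_def atLeast0LessThan)
  moreover have "?M $$ (j, i) = ?M $$ (i, j)" if "i < n" "j < n" for i j
    using arg_cong[OF transpose_root_prod[OF A sym, of rs], of "\<lambda>X. X $$ (i, j)"] M that by auto
  \<comment> \<open>By symmetry the trace of \<open>?M * ?M\<close> is the sum of the squares of all
    entries, so over the reals its vanishing kills every entry.\<close>
  ultimately have "(\<Sum>i<n. \<Sum>j<n. (?M $$ (i, j))\<^sup>2) = 0"
    by (simp add: power2_eq_square)
  then have "?M $$ (i, j) = 0" if "i < n" "j < n" for i j
    using that by (simp add: sum_nonneg_eq_0_iff sum_nonneg)
  then show ?thesis using M by (intro eq_matI) auto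
qed

section \<open>Walk counts and the maximum principle\<close>

context digraph
begin

text \<open>Without parallel arcs \<open>head G\<close> is injective on the arcs leaving
  \<open>u\<close>. This links sums over arcs, natural for walks, to sums over vertices, natural for
  matrix products.\<close>

lemma sum_out_arcs:
  fixes g :: "'a \<Rightarrow> 'c :: comm_monoid_add"
  shows "(\<Sum>e\<in>out_arcs G u. g (head G e)) = (\<Sum>v\<in>verts G. if u \<rightarrow>\<^bsub>G\<^esub> v then g v else 0)"
proof -
  have inj: "inj_on (head G) (out_arcs G u)"
    by (rule inj_onI) (auto intro!: no_multi_arcs simp: arc_to_ends_def)
  have "head G ` out_arcs G u = {v \<in> verts G. u \<rightarrow>\<^bsub>G\<^esub> v}"
    by (force simp: arcs_ends_def arc_to_ends_def image_iff)
  then have "(\<Sum>e\<in>out_arcs G u. g (head G e)) = (\<Sum>v\<in>{v \<in> verts G. u \<rightarrow>\<^bsub>G\<^esub> v}. g v)"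
    using sum.reindex[OF inj, of g] by simp
  also have "\<dots> = (\<Sum>v\<in>verts G. if u \<rightarrow>\<^bsub>G\<^esub> v then g v else 0)"
    by (subst sum.inter_filter) simp_all
  finally show ?thesis .
qed

lemma num_walks_0:
  assumes "u \<in> verts G"
  shows "num_walks G 0 u v = (if u = v then 1 else 0)"
proof -
  have "{p. awalk u p v \<and> length p = 0} = (if u = v then {[]} else {})"
    using assms by (auto simp: awalk_Nil_iff)
  then show ?thesis by (simp add: num_walks_def)
qed

lemma finite_walks: "finite {p. awalk u p v \<and> length p = l}"
  by (rule finite_subset[OF _ finite_lists_length_eq[OF finite_arcs, of l]]) (auto simp: awalk_def)

text \<open>Walks are split by their first arc. In matrix terms this is left multiplication by the
  adjacency matrix.\<close>

lemma num_walks_Suc: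
  "num_walks G (Suc l) u v = (\<Sum>e\<in>out_arcs G u. num_walks G l (head G e) v)"
proof -
  have "{p. awalk u p v \<and> length p = Suc l} =
      (\<Union>e\<in>out_arcs G u. (#) e ` {p. awalk (head G e) p v \<and> length p = l})"
    by (auto simp: length_Suc_conv awalk_Cons_iff)
  moreover have "card (\<Union>e\<in>out_arcs G u. (#) e ` {p. awalk (head G e) p v \<and> length p = l}) =
      (\<Sum>e\<in>out_arcs G u. card ((#) e ` {p. awalk (head G e) p v \<and> length p = l}))"
    by (intro card_UN_disjoint) (auto intro: finite_walks)
  moreover have "card ((#) e ` {p. awalk (head G e) p v \<and> length p = l}) =
      num_walks G l (head G e) v" for e
    unfolding num_walks_def by (intro card_image) auto
  ultimately show ?thesis by (simp add: num_walks_def)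
qed

lemma num_walks_1:
  assumes "v \<in> verts G"
  shows "num_walks G 1 u v = (if u \<rightarrow>\<^bsub>G\<^esub> v then 1 else 0)"
proof -
  have "num_walks G 1 u v = (\<Sum>e\<in>out_arcs G u. if head G e = v then 1 else 0)"
    by (auto simp: num_walks_Suc num_walks_0 intro!: sum.cong)
  also have "\<dots> = (\<Sum>w\<in>verts G. if w = v then (if u \<rightarrow>\<^bsub>G\<^esub> v then 1 else 0) else 0)"
    unfolding sum_out_arcs[of "\<lambda>w. if w = v then 1 else 0"] by (intro sum.cong) auto
  finally show ?thesis using assms by simp
qed

text \<open>The maximum principle: the set where \<open>f\<close> attains its maximum is closed under taking neighbours.\<close>
lemma regular_eigenfunction_constant:
  fixes f :: "'a \<Rightarrow> real"
  assumes sc: "strongly_connected G" and reg: "regular_of_valency G k"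
    and f: "\<And>u. u \<in> verts G \<Longrightarrow> (\<Sum>e\<in>out_arcs G u. f (head G e)) = real k * f u"
    and uv: "u \<in> verts G" "v \<in> verts G"
  shows "f u = f v"
proof -
  have ne: "finite (f ` verts G)" "f ` verts G \<noteq> {}" using uv by auto
  define m where "m = Max (f ` verts G)"
  have le: "f w \<le> m" if "w \<in> verts G" for w using that ne by (simp add: m_def)
  obtain w where w: "w \<in> verts G" "f w = m"
    using Max_in[OF ne] unfolding m_def by auto
  have "f x = m" if "w \<rightarrow>\<^sup>*\<^bsub>G\<^esub> x" for x
    using that
  proof (induction rule: reachable_induct)
    case base
    then show ?case by (simp add: w)
  next
    case (step x y)
    then have x: "x \<in> verts G" by (auto elim: reachable_in_vertsE)
    obtain e where e: "e \<in> out_arcs G x" "head G e = y"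
      using step(2) by (auto simp: arcs_ends_def arc_to_ends_def)
    \<comment> \<open>Since \<open>x\<close> has \<open>k\<close> out-arcs and
      \<open>f x = m\<close>, the sum is \<open>k * m - k * m\<close>. Its terms are nonnegative, so
      each of them vanishes.\<close>
    have "(\<Sum>e\<in>out_arcs G x. m - f (head G e)) = 0"
      using f[OF x] reg x step by (simp add: sum_subtractf regular_of_valency_def out_degree_def)
    moreover have "0 \<le> m - f (head G e)" if "e \<in> out_arcs G x" for e
      using that by (auto intro: le)
    ultimately have "m - f (head G e) = 0"
      using e(1) by (meson finite_out_arcs sum_nonneg_eq_0_iff)
    then show ?case using e by simp
  qed
  then show ?thesis using sc w uv unfolding strongly_connected_def by metis
qed

text \<open>In matrix terms, \<open>A^(2m+1) = a A + b J\<close> is multiplied twice by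
  \<open>A\<close>. Row sums \<open>k\<close> give \<open>A J = k J\<close>, and the resulting
  \<open>A^3\<close> is reduced by \<open>three\<close>.\<close>

lemma num_walks_odd:
  assumes reg: "regular_of_valency G k"
    and three: "\<And>u v. u \<in> verts G \<Longrightarrow> v \<in> verts G \<Longrightarrow>
      real (num_walks G 3 u v) = s * real (num_walks G 1 u v) + c"
  shows "\<exists>a b. \<forall>u\<in>verts G. \<forall>v\<in>verts G.
    real (num_walks G (2 * m + 1) u v) = a * real (num_walks G 1 u v) + b"
proof (induction m)
  case 0
  show ?case by (rule exI[of _ 1], rule exI[of _ 0]) simp
next
  case (Suc m)
  then obtain a b where ab: "\<And>u v. u \<in> verts G \<Longrightarrow> v \<in> verts G \<Longrightarrow>
    real (num_walks G (2 * m + 1) u v) = a * real (num_walks G 1 u v) + b" by blast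
  \<comment> \<open>Stated for general lengths and coefficients because it is used twice, the second
    time with \<open>b * k\<close> in place of \<open>b\<close>.\<close>
  have step: "real (num_walks G (Suc l) u v) = a * real (num_walks G (Suc i) u v) + b * real k"
    if l: "\<And>u. u \<in> verts G \<Longrightarrow> real (num_walks G l u v) = a * real (num_walks G i u v) + b"
      and u: "u \<in> verts G" for l i u v a b
  proof -
    have "real (num_walks G (Suc l) u v) =
        (\<Sum>e\<in>out_arcs G u. a * real (num_walks G i (head G e) v) + b)"
      by (auto simp: num_walks_Suc l intro!: sum.cong)
    also have "\<dots> = a * real (num_walks G (Suc i) u v) + b * real k"
      using reg u by (simp add: num_walks_Suc sum.distrib sum_distrib_left
        regular_of_valency_def out_degree_def)
    finally show ?thesis .
  qed
  have "real (num_walks G (2 * Suc m + 1) u v) =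
      (a * s) * real (num_walks G 1 u v) + (a * c + b * real k * real k)"
    if "u \<in> verts G" "v \<in> verts G" for u v
  proof -
    have "real (num_walks G (Suc (Suc (2 * m + 1))) u v) =
        a * real (num_walks G (Suc (Suc 1)) u v) + b * real k * real k"
      using that ab by (intro step)
    also have "Suc (Suc 1) = 3" by simp
    finally show ?thesis using three[OF that] by (simp add: distrib_left mult.assoc)
  qed
  then show ?case by blast
qed

lemma strongly_walk_regularI:
  assumes l: "1 < l"
    and ab: "\<And>u v. u \<in> verts G \<Longrightarrow> v \<in> verts G \<Longrightarrow>
      real (num_walks G l u v) = a * real (num_walks G 1 u v) + b"
  shows "strongly_walk_regular G l"
proof -
  \<comment> \<open>The parameters must be natural numbers while \<open>a\<close> and
    \<open>b\<close> are real. In each case that occurs the real value is a count, so rounding down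
    changes nothing.\<close>
  have "num_walks G l u v = nat \<lfloor>if u \<rightarrow>\<^bsub>G\<^esub> v then a + b else b\<rfloor>"
    if "u \<in> verts G" "v \<in> verts G" for u v
  proof -
    have "num_walks G l u v = nat \<lfloor>real (num_walks G l u v)\<rfloor>" by simp
    also have "real (num_walks G l u v) = (if u \<rightarrow>\<^bsub>G\<^esub> v then a + b else b)"
      unfolding ab[OF that] num_walks_1[OF that(2)] by simp
    finally show ?thesis .
  qed
  \<comment> \<open>Without loops the closed walks fall under the non-adjacent case, so
    \<open>nat \<lfloor>b\<rfloor>\<close> serves as both \<open>mu\<close> and
    \<open>nu\<close>.\<close>
  moreover have "\<not> u \<rightarrow>\<^bsub>G\<^esub> u" for u
    by (auto simp: arcs_ends_def arc_to_ends_def dest: no_loops)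
  ultimately have "strongly_walk_regular_with G l (nat \<lfloor>a + b\<rfloor>) (nat \<lfloor>b\<rfloor>) (nat \<lfloor>b\<rfloor>)"
    using l by (simp add: strongly_walk_regular_with_def)
  then show ?thesis unfolding strongly_walk_regular_def by blast
qed

end

section \<open>Matrices indexed by vertices\<close>

definition vertex_mat :: "'a list \<Rightarrow> ('a \<Rightarrow> 'a \<Rightarrow> 'c) \<Rightarrow> 'c mat" where
  "vertex_mat vs g = mat (length vs) (length vs) (\<lambda>(i, j). g (vs ! i) (vs ! j))"

lemma vertex_mat_carrier [simp]: "vertex_mat vs g \<in> carrier_mat (length vs) (length vs)"
  by (simp add: vertex_mat_def)

lemma vertex_mat_dim [simp]:
  "dim_row (vertex_mat vs g) = length vs" "dim_col (vertex_mat vs g) = length vs"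
  by (simp_all add: vertex_mat_def)

lemma vertex_mat_eq_iff:
  "vertex_mat vs g = vertex_mat vs h \<longleftrightarrow> (\<forall>u\<in>set vs. \<forall>v\<in>set vs. g u v = h u v)"
  by (auto simp: vertex_mat_def mat_eq_iff all_set_conv_all_nth)

lemma transpose_vertex_mat: "transpose_mat (vertex_mat vs g) = vertex_mat vs (\<lambda>u v. g v u)"
  by (auto simp: vertex_mat_def mat_eq_iff)

lemma adjacency_matrix_eq_vertex_mat:
  "adjacency_matrix G vs = vertex_mat vs (\<lambda>u v. if u \<rightarrow>\<^bsub>G\<^esub> v then 1 else 0)"
  by (simp add: adjacency_matrix_def vertex_mat_def)

context digraph
begin

text \<open>The bridge from matrix algebra to walk counts: one factor of \<open>root_prod\<close>
  becomes an operation on functions of two vertices, of the same shape as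
  \<open>num_walks_Suc\<close>.\<close>

lemma adjacency_matrix_minus_mult_vertex_mat:
  assumes vs: "distinct vs" "set vs = verts G"
  shows "(adjacency_matrix G vs - r \<cdot>\<^sub>m 1\<^sub>m (length vs)) * vertex_mat vs g =
    vertex_mat vs (\<lambda>u v. (\<Sum>e\<in>out_arcs G u. g (head G e) v) - r * g u v)"
proof -
  let ?n = "length vs" and ?A = "adjacency_matrix G vs"
  have A: "?A \<in> carrier_mat ?n ?n" by (simp add: adjacency_matrix_eq_vertex_mat)
  have bij: "bij_betw ((!) vs) {0..<?n} (verts G)"
    using bij_betw_nth[OF vs(1), of "{0..<?n}"] vs(2) by (simp add: atLeast0LessThan)
  have "(?A * vertex_mat vs g) $$ (i, j) = (\<Sum>e\<in>out_arcs G (vs ! i). g (head G e) (vs ! j))"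
    if "i < ?n" "j < ?n" for i j
  proof -
    have "(?A * vertex_mat vs g) $$ (i, j) =
        (\<Sum>m = 0..<?n. if vs ! i \<rightarrow>\<^bsub>G\<^esub> vs ! m then g (vs ! m) (vs ! j) else 0)"
      using that by (auto simp: adjacency_matrix_def vertex_mat_def scalar_prod_def intro!: sum.cong)
    then show ?thesis
      unfolding sum_out_arcs[of "\<lambda>w. g w (vs ! j)"] by (simp add: sum.reindex_bij_betw[OF bij, symmetric])
  qed
  then show ?thesis
    unfolding mult_minus_smult_one(2)[OF A vertex_mat_carrier]
    by (intro eq_matI) (simp_all add: vertex_mat_def)
qed

end

theorem proposition4p2:
  fixes G :: "('a, 'b) pre_digraph"
    and k l :: nat
    and \<theta>\<^sub>1 \<theta>\<^sub>2 \<theta>\<^sub>3 :: real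
  assumes "graph G"
    and "Digraph_Component.connected G"
    and "regular_of_valency G k"
    and "graph_spectrum G = {real k, \<theta>\<^sub>1, \<theta>\<^sub>2, \<theta>\<^sub>3}"
    and "real k > \<theta>\<^sub>1" and "\<theta>\<^sub>1 > \<theta>\<^sub>2" and "\<theta>\<^sub>2 > \<theta>\<^sub>3"
    and "\<theta>\<^sub>2 = 0" and "\<theta>\<^sub>3 = - \<theta>\<^sub>1"
    and "odd l" and "l > 1"
  shows "strongly_walk_regular G l"
proof -
  interpret graph G by fact
  let ?t = "\<theta>\<^sub>1"
  \<comment> \<open>The maximum principle follows directed paths; symmetry of the arcs provides
    them.\<close>
  have sc: "strongly_connected G"
    using symmetric_connected_imp_strongly_connected assms(2) sym_arcs by blast
  obtain vs where vs: "set vs = verts G" "distinct vs"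
    using finite_distinct_list[OF finite_verts] by blast
  define n where "n = length vs"
  define A where "A = adjacency_matrix G vs"
  have A: "A \<in> carrier_mat n n" by (simp add: A_def adjacency_matrix_eq_vertex_mat n_def)
  have sym: "transpose_mat A = A"
    unfolding A_def adjacency_matrix_eq_vertex_mat transpose_vertex_mat vertex_mat_eq_iff
    using sym_arcs by (auto simp: symmetric_def sym_def)
  define walks where "walks l u v = real (num_walks G l u v)" for l u v
  have walks_Suc: "(\<Sum>e\<in>out_arcs G u. walks l (head G e) v) = walks (Suc l) u v" for l u v
    by (simp add: walks_def num_walks_Suc)
  \<comment> \<open>The entries of \<open>A^3 - ?t^2 A\<close>, the product of
    \<open>A - ?t I\<close>, \<open>A\<close> and \<open>A + ?t I\<close>.\<close>
  define h where "h u v = walks 3 u v - ?t\<^sup>2 * walks 1 u v" for u v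
  note step = adjacency_matrix_minus_mult_vertex_mat[OF vs(2,1), folded A_def n_def]
  \<comment> \<open>The identity matrix counts walks of length 0; distinctness of \<open>vs\<close>
    makes equal vertices mean equal indices.\<close>
  have Nil: "root_prod A [] = vertex_mat vs (walks 0)"
    using A vs(2) vs(1)[symmetric]
    by (auto simp: vertex_mat_def n_def mat_eq_iff walks_def num_walks_0 nth_eq_iff_index_eq)
  have Cons: "root_prod A (r # rs) =
      vertex_mat vs (\<lambda>u v. (\<Sum>e\<in>out_arcs G u. g (head G e) v) - r * g u v)"
    if "root_prod A rs = vertex_mat vs g" for r rs g
    using A that by (simp add: step)
  have h: "root_prod A [?t, 0, - ?t] = vertex_mat vs h"
    unfolding Cons[OF Cons[OF Cons[OF Nil]]] vertex_mat_eq_iff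
    by (simp add: walks_Suc sum.distrib sum_distrib_left[symmetric]
      h_def power2_eq_square algebra_simps numeral_3_eq_3)
  have "root_prod A [real k, ?t, 0, - ?t] = 0\<^sub>m n n"
  proof (rule root_prod_symmetric_real_eq_0[OF A sym])
    fix e assume "eigenvalue A e"
    then show "e \<in> set [real k, ?t, 0, - ?t]"
      using assms(4,8,9) vs unfolding graph_spectrum_def A_def by auto
  qed
  \<comment> \<open>With \<open>k\<close> first in the list, its factor is outermost, so each column
    of \<open>h\<close> satisfies the eigenvalue equation for \<open>k\<close>.\<close>
  then have "(A - real k \<cdot>\<^sub>m 1\<^sub>m n) * vertex_mat vs h = 0\<^sub>m n n"
    using A h by (simp only: root_prod.simps carrier_matD)
  also have "\<dots> = vertex_mat vs (\<lambda>u v. 0)"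
    by (auto simp: vertex_mat_def n_def mat_eq_iff)
  finally have eig: "(\<Sum>e\<in>out_arcs G u. h (head G e) v) = real k * h u v"
    if "u \<in> verts G" "v \<in> verts G" for u v
    using that vs by (simp add: step vertex_mat_eq_iff)
  have col: "h u v = h u' v" if "u \<in> verts G" "u' \<in> verts G" "v \<in> verts G" for u u' v
    by (rule regular_eigenfunction_constant[OF sc assms(3), where f = "\<lambda>u. h u v"])
      (use eig that in auto)
  have h_sym: "h u v = h v u" if "u \<in> verts G" "v \<in> verts G" for u v
    using transpose_root_prod[OF A sym, of "[?t, 0, - ?t]"] that vs
    unfolding h transpose_vertex_mat vertex_mat_eq_iff by blast
  obtain w where w: "w \<in> verts G" using sc unfolding strongly_connected_def by blast
  \<comment> \<open>The chain is \<open>h u v = h w v = h v w = h w w\<close>: constant column,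
    symmetry, constant column.\<close>
  have "h u v = h w w" if "u \<in> verts G" "v \<in> verts G" for u v
    using col[OF that(1) w that(2)] h_sym[OF w that(2)] col[OF that(2) w w] by simp
  then have three: "real (num_walks G 3 u v) = ?t\<^sup>2 * real (num_walks G 1 u v) + h w w"
    if "u \<in> verts G" "v \<in> verts G" for u v
    using that by (fastforce simp: h_def walks_def)
  obtain m where m: "l = 2 * m + 1" using \<open>odd l\<close> by (elim oddE)
  show ?thesis
    using num_walks_odd[OF assms(3) three, of m] strongly_walk_regularI[OF \<open>l > 1\<close>] unfolding m by blast
qed

end
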